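(* For every integer $n\ge 2$, $$\tau(n)\le \left(\frac{\eta_2\log n}{\omega(n)\log_+ \omega(n)}\right)^{\omega(n)},$$ where $$\eta_2:=\exp\biggl(\frac{1}{6}\log 96-\log\Bigl(\frac{\log 60060}{6\log 6}\Bigr)\biggr)= 2.0907132\dots$$
   Context: $\tau(n)$ denotes the number of positive divisors of $n$, $\omega(n)$ the number of distinct prime factors of $n$, and $\log_+ x:=\log\max(2,x)$. *)

theory Defs
  imports Complex_Main "HOL-Computational_Algebra.Primes"
begin

definition tau :: "nat \<Rightarrow> nat" where
  "tau n = card {d. d dvd n}"

definition omega :: "nat \<Rightarrow> nat" where
  "omega n = card (prime_factors n)"

definition log_plus :: "real \<Rightarrow> real" where
  "log_plus x = ln (max 2 x)"

definition eta2 :: real where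
  "eta2 = exp (1 / 6 * ln 96 - ln (ln 60060 / (6 * ln 6)))"

end

theory Submission
  imports Defs "HOL-Analysis.Harmonic_Numbers"
begin

text \<open>
  Let \<open>a\<^sub>0, \<dots>, a\<^sub>k\<^sub>-\<^sub>1\<close> be the exponents of the prime factors of \<open>n\<close> in increasing order of the primes.
  Replacing the \<open>i\<close>-th prime factor by the \<open>i\<close>-th prime only decreases \<open>n\<close>, so with \<open>L\<^sub>i = ln p\<^sub>i\<close> and
  \<open>S = \<Sum> a\<^sub>i L\<^sub>i\<close> it suffices to bound \<open>\<Prod> (a\<^sub>i + 1)\<close> by \<open>(\<eta> S / (k log k))\<^sup>k\<close>. For weights \<open>w\<^sub>i \<le> L\<^sub>i\<close> with
  \<open>2 \<Sum> w\<^sub>i \<le> \<Sum> L\<^sub>i\<close>, the condition \<open>a\<^sub>i \<ge> 1\<close> gives \<open>\<Sum> w\<^sub>i (a\<^sub>i + 1) \<le> S\<close>, and the arithmetic-geometric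
  mean inequality yields \<open>\<Prod> w\<^sub>i \<Prod> (a\<^sub>i + 1) \<le> (S / k)\<^sup>k\<close>; hence \<open>(log k)\<^sup>k \<le> \<eta>\<^sup>k \<Prod> w\<^sub>i\<close> is enough.

  For \<open>k \<ge> 25\<close> take \<open>w\<^sub>i = L\<^sub>i / 2\<close>: then the required bound for \<open>\<Prod> ln p\<^sub>i\<close> follows by induction on \<open>k\<close>
  from \<open>p\<^sub>i \<ge> 3 (i + 1)\<close>, a consequence of sieving by 2 and 3. For \<open>k < 25\<close>, \<open>k \<noteq> 6\<close>, the truncation
  \<open>w\<^sub>i = min h L\<^sub>i\<close> works for a suitable \<open>h\<close>. It fails for \<open>k = 6\<close>, where equality holds at
  \<open>60060 = 2\<^sup>2 \<cdot> 3 \<cdot> 5 \<cdot> 7 \<cdot> 11 \<cdot> 13\<close> and one has to use that the exponent of 2 is an integer.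
\<close>

section \<open>A weighted form of the arithmetic-geometric mean inequality\<close>

lemma prod_le_mean_power:
  fixes x :: "nat \<Rightarrow> real"
  assumes "k > 0" "\<And>i. i < k \<Longrightarrow> 0 \<le> x i"
  shows "(\<Prod>i<k. x i) \<le> ((\<Sum>i<k. x i) / k) ^ k"
proof -
  define P where "P = (\<Prod>i<k. x i)"
  have "0 \<le> P"
    unfolding P_def by (intro prod_nonneg) (use assms in auto)
  have "P powr (1 / k) \<le> (\<Sum>i<k. x i) / k"
    using arith_geom_mean[of "{..<k}" x] assms by (auto simp: sum_divide_distrib P_def)
  then have "(P powr (1 / k)) ^ k \<le> ((\<Sum>i<k. x i) / k) ^ k"
    by (intro power_mono) auto
  also have "(P powr (1 / k)) ^ k = P"
    using assms(1) \<open>0 \<le> P\<close> by (cases "P = 0") (auto simp: powr_power)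
  finally show ?thesis
    by (simp add: P_def)
qed

text \<open>Here \<open>b\<close> is a reference point: \<open>balance\<close> bounds the weighted
  sum of \<open>b i + 1\<close>, and by \<open>slope\<close> the bound survives the move from
  \<open>b\<close> to \<open>a\<close>. A coordinate with \<open>a i = b i\<close> puts no upper
  bound on \<open>w i\<close>, which is what the case of six primes exploits.\<close>

lemma prod_Suc_le_of_weights:
  fixes a b L w :: "nat \<Rightarrow> real"
  assumes "k > 0"
    and a: "\<And>i. i < k \<Longrightarrow> 0 \<le> a i"
    and w: "\<And>i. i < k \<Longrightarrow> 0 \<le> w i"
    and slope: "\<And>i. i < k \<Longrightarrow> w i * (a i - b i) \<le> L i * (a i - b i)"
    and balance: "(\<Sum>i<k. w i * (b i + 1)) \<le> (\<Sum>i<k. b i * L i)"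
  shows "(\<Prod>i<k. w i) * (\<Prod>i<k. a i + 1) \<le> ((\<Sum>i<k. a i * L i) / k) ^ k"
proof -
  have "(\<Sum>i<k. w i * (a i + 1)) = (\<Sum>i<k. w i * (b i + 1)) + (\<Sum>i<k. w i * (a i - b i))"
    by (simp add: algebra_simps flip: sum.distrib)
  also have "\<dots> \<le> (\<Sum>i<k. b i * L i) + (\<Sum>i<k. L i * (a i - b i))"
    by (intro add_mono balance sum_mono slope) auto
  also have "\<dots> = (\<Sum>i<k. a i * L i)"
    by (simp add: algebra_simps flip: sum.distrib)
  finally have le: "(\<Sum>i<k. w i * (a i + 1)) \<le> (\<Sum>i<k. a i * L i)" .
  have "(\<Prod>i<k. w i) * (\<Prod>i<k. a i + 1) = (\<Prod>i<k. w i * (a i + 1))"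
    by (simp add: prod.distrib)
  also have "\<dots> \<le> ((\<Sum>i<k. w i * (a i + 1)) / k) ^ k"
    using a w by (intro prod_le_mean_power assms) auto
  also have "\<dots> \<le> ((\<Sum>i<k. a i * L i) / k) ^ k"
    using a w le by (intro power_mono divide_right_mono divide_nonneg_nonneg sum_nonneg) auto
  finally show ?thesis .
qed

section \<open>Numerical bounds for logarithms\<close>

text \<open>Partial sums of ln x = 2 artanh ((x - 1) / (x + 1)), with the tail majorized by a
  geometric series.\<close>

lemma ln_atanh_bounds:
  fixes x :: real
  assumes "1 < x"
  shows "(\<Sum>k<n. 2 * ((x - 1) / (x + 1)) ^ (2 * k + 1) / real (2 * k + 1)) \<le> ln x"
    and "ln x \<le> (\<Sum>k<n. 2 * ((x - 1) / (x + 1)) ^ (2 * k + 1) / real (2 * k + 1)) +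
      2 * (((x - 1) / (x + 1)) ^ (2 * n + 1) / (1 - ((x - 1) / (x + 1))\<^sup>2) / real (2 * n + 1))"
  using ln_approx_bounds[OF assms, of n] by auto

text \<open>The first term of the artanh series for ln (b / a). It carries bounds from one number to
  a close neighbour.\<close>

lemma ln_diff_ge:
  fixes a b :: real
  assumes "0 < a" "a < b"
  shows "2 * (b - a) / (b + a) \<le> ln b - ln a"
proof -
  have "b / a - 1 = (b - a) / a" "b / a + 1 = (b + a) / a"
    using assms by (simp_all add: field_simps)
  then have "(b / a - 1) / (b / a + 1) = (b - a) / (b + a)"
    using assms by simp
  then show ?thesis
    using ln_atanh_bounds(1)[of "b / a" 1] assms by (simp add: ln_div)
qed

lemma ln_2_bounds: "ln (2::real) \<in> {0.693147180559..0.693147180560}"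
  using ln_atanh_bounds[of 2 12] by (simp add: eval_nat_numeral)

text \<open>The series converges fast near 1, so from here on each prime p up to 13 is reached
  through ln (p / (p - 1)), where p - 1 has only smaller prime factors.\<close>

lemma ln_3_bounds: "ln (3::real) \<in> {1.098612288667..1.098612288669}"
proof -
  have "ln (3 / 2 :: real) \<in> {0.405465108108..0.405465108109}"
    using ln_atanh_bounds[of "3 / 2" 9] by (simp add: eval_nat_numeral)
  then show ?thesis
    using ln_2_bounds by (simp add: ln_div)
qed

lemma ln_5_bounds: "ln (5::real) \<in> {1.609437912432..1.609437912435}"
proof -
  have "ln (5 / 4 :: real) \<in> {0.223143551314..0.223143551315}"
    using ln_atanh_bounds[of "5 / 4" 7] by (simp add: eval_nat_numeral)
  moreover have "ln (4::real) = 2 * ln 2"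
    using ln_realpow[of 2 2] by simp
  ultimately show ?thesis
    using ln_2_bounds by (simp add: ln_div)
qed

lemma ln_numeral_mult:
  assumes "numeral m * numeral n = (numeral q :: real)"
  shows "ln (numeral q :: real) = ln (numeral m) + ln (numeral n)"
  using ln_mult[of "numeral m :: real" "numeral n"] assms by simp

lemma ln_7_bounds: "ln (7::real) \<in> {1.945910149053..1.945910149057}"
proof -
  have "ln (7 / 6 :: real) \<in> {0.154150679827..0.154150679828}"
    using ln_atanh_bounds[of "7 / 6" 6] by (simp add: eval_nat_numeral)
  moreover have "ln (6::real) = ln 2 + ln 3"
    by (rule ln_numeral_mult) simp
  ultimately show ?thesis
    using ln_2_bounds ln_3_bounds by (simp add: ln_div)
qed

lemma ln_11_bounds: "ln (11::real) \<in> {2.397895272795..2.397895272800}"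
proof -
  have "ln (11 / 10 :: real) \<in> {0.095310179804..0.095310179805}"
    using ln_atanh_bounds[of "11 / 10" 6] by (simp add: eval_nat_numeral)
  moreover have "ln (10::real) = ln 2 + ln 5"
    by (rule ln_numeral_mult) simp
  ultimately show ?thesis
    using ln_2_bounds ln_5_bounds by (simp add: ln_div)
qed

lemma ln_13_bounds: "ln (13::real) \<in> {2.564949357458..2.564949357463}"
proof -
  have "ln (13 / 12 :: real) \<in> {0.080042707673..0.080042707674}"
    using ln_atanh_bounds[of "13 / 12" 6] by (simp add: eval_nat_numeral)
  moreover have "ln (12::real) = ln 4 + ln 3" "ln (4::real) = ln 2 + ln 2"
    by (rule ln_numeral_mult; simp)+
  ultimately show ?thesis
    using ln_2_bounds ln_3_bounds by (simp add: ln_div)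
qed

lemmas ln_small_prime_bounds =
  ln_2_bounds ln_3_bounds ln_5_bounds ln_7_bounds ln_11_bounds ln_13_bounds

lemma ln_composites:
  "ln (4::real) = ln 2 + ln 2" "ln (6::real) = ln 2 + ln 3" "ln (8::real) = ln 2 + ln 4"
  "ln (9::real) = ln 3 + ln 3" "ln (10::real) = ln 2 + ln 5" "ln (12::real) = ln 2 + ln 6"
  "ln (14::real) = ln 2 + ln 7" "ln (15::real) = ln 3 + ln 5" "ln (16::real) = ln 2 + ln 8"
  "ln (18::real) = ln 2 + ln 9" "ln (20::real) = ln 2 + ln 10" "ln (21::real) = ln 3 + ln 7"
  "ln (22::real) = ln 2 + ln 11" "ln (24::real) = ln 2 + ln 12" "ln (25::real) = ln 5 + ln 5"
  "ln (28::real) = ln 2 + ln 14" "ln (30::real) = ln 2 + ln 15" "ln (36::real) = ln 2 + ln 18"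
  "ln (40::real) = ln 2 + ln 20" "ln (42::real) = ln 2 + ln 21" "ln (45::real) = ln 3 + ln 15"
  "ln (52::real) = ln 4 + ln 13" "ln (56::real) = ln 2 + ln 28" "ln (60::real) = ln 2 + ln 30"
  "ln (66::real) = ln 3 + ln 22" "ln (70::real) = ln 5 + ln 14" "ln (72::real) = ln 2 + ln 36"
  "ln (78::real) = ln 6 + ln 13" "ln (81::real) = ln 9 + ln 9" "ln (88::real) = ln 4 + ln 22"
  "ln (96::real) = ln 4 + ln 24"
  by (rule ln_numeral_mult; simp)+

section \<open>Tables of logarithms\<close>

definition small_primes :: "nat list" where
  "small_primes = [2, 3, 5, 7, 11, 13, 17, 19, 23, 29, 31, 37, 41, 43, 47, 53, 59, 61, 67, 71, 73,
    79, 83, 89, 97]"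

definition ln_lower :: "real list" where
  "ln_lower = [0.693, 1.098, 1.609, 1.945, 2.397, 2.564, 2.833, 2.944, 3.135, 3.367, 3.433,
    3.610, 3.713, 3.761, 3.850, 3.970, 4.077, 4.110, 4.204, 4.262, 4.290, 4.369,
    4.418, 4.488, 4.574]"

text \<open>The first two entries agree because \<open>log_plus\<close> equals ln 2 at both 1 and
  2.\<close>

definition ln_upper :: "real list" where
  "ln_upper = [0.694, 0.694, 1.099, 1.387, 1.610, 1.792, 1.946, 2.080, 2.198, 2.303, 2.398,
    2.485, 2.565, 2.640, 2.709, 2.773, 2.834, 2.891, 2.945, 2.996, 3.045, 3.092,
    3.136, 3.179]"

text \<open>Each prime from 17 on is compared with a slightly smaller number whose prime factors are
  at most 13. For the upper bounds on ln 17, ln 19 and ln 23 below, the neighbour is the next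
  integer instead.\<close>

lemma ln_lower_small_primes: "list_all2 (\<lambda>p l. l \<le> ln (real p)) small_primes ln_lower"
  unfolding small_primes_def ln_lower_def
  using ln_small_prime_bounds ln_composites
    ln_diff_ge[of 16 17] ln_diff_ge[of 18 19] ln_diff_ge[of 22 23] ln_diff_ge[of 28 29]
    ln_diff_ge[of 30 31] ln_diff_ge[of 36 37] ln_diff_ge[of 40 41] ln_diff_ge[of 42 43]
    ln_diff_ge[of 45 47] ln_diff_ge[of 52 53] ln_diff_ge[of 56 59] ln_diff_ge[of 60 61]
    ln_diff_ge[of 66 67] ln_diff_ge[of 70 71] ln_diff_ge[of 72 73] ln_diff_ge[of 78 79]
    ln_diff_ge[of 81 83] ln_diff_ge[of 88 89] ln_diff_ge[of 96 97]
  by simp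

lemma log_plus_upper: "list_all2 (\<lambda>k u. log_plus (real k) \<le> u) [1..<25] ln_upper"
  unfolding ln_upper_def
  using ln_small_prime_bounds ln_composites
    ln_diff_ge[of 17 18] ln_diff_ge[of 19 20] ln_diff_ge[of 23 24]
  by (simp add: upt_conv_Cons log_plus_def)


lemma ln_60060: "ln (60060::real) = 2 * ln 2 + ln 3 + ln 5 + ln 7 + ln 11 + ln 13"
proof -
  have "ln (60060::real) = ln 60 + ln 1001" "ln (1001::real) = ln 7 + ln 143"
    "ln (143::real) = ln 11 + ln 13"
    by (rule ln_numeral_mult; simp)+
  then show ?thesis
    by (simp add: ln_composites)
qed

section \<open>The constant\<close>

lemma eta2_pos: "0 < eta2"
  by (simp add: eta2_def)

text \<open>This is the equality case at 60060, which has 96 divisors and six prime factors. The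
  sixth power removes the exponential, so estimates for \<open>eta2\<close> reduce to estimates for
  logarithms.\<close>

lemma eta2_power_6: "eta2 ^ 6 = 96 * (6 * ln 6 / ln 60060) ^ 6"
proof -
  have "0 < ln 60060 / (6 * ln (6::real))"
    by simp
  then have "eta2 = exp (1 / 6 * ln 96) / (ln 60060 / (6 * ln 6))"
    by (simp only: eta2_def exp_diff exp_ln)
  then have "eta2 = exp (1 / 6 * ln 96) * (6 * ln 6 / ln 60060)"
    by simp
  then have "eta2 ^ 6 = exp (1 / 6 * ln 96) ^ 6 * (6 * ln 6 / ln 60060) ^ 6"
    by (metis power_mult_distrib)
  also have "exp (1 / 6 * ln 96) ^ 6 = (96::real)"
    by (simp flip: exp_of_nat_mult)
  finally show ?thesis .
qed

lemma eta2_bounds: "2.0907132 \<le> eta2" "eta2 < 2.0907133"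
proof -
  have ln6: "1.791759469226 \<le> ln (6::real)" "ln (6::real) \<le> 1.791759469229"
    and ln60060: "11.00309934151 \<le> ln (60060::real)" "ln (60060::real) \<le> 11.00309934155"
    using ln_small_prime_bounds ln_composites ln_60060 by simp_all
  have "(2.0907132::real) ^ 6 \<le> 96 * (6 * 1.791759469226 / 11.00309934155) ^ 6"
    by (simp add: power_divide)
  also have "\<dots> \<le> eta2 ^ 6"
    unfolding eta2_power_6 using ln6 ln60060
    by (intro mult_left_mono power_mono frac_le mult_left_mono) auto
  finally show "2.0907132 \<le> eta2"
    using eta2_pos power_mono_iff[of "2.0907132" eta2 6] by simp
  have "eta2 ^ 6 \<le> 96 * (6 * 1.791759469229 / 11.00309934151) ^ 6"
    unfolding eta2_power_6 using ln6 ln60060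
    by (intro mult_left_mono power_mono frac_le mult_left_mono) auto
  also have "\<dots> < (2.0907133::real) ^ 6"
    by (simp add: power_divide)
  finally show "eta2 < 2.0907133"
    by (rule power_less_imp_less_base) simp
qed

section \<open>Lower bounds for the prime factors\<close>

text \<open>The linear branch makes ln (prime_lower k) equal to ln 3 + ln (k + 1), the form used in
  the induction for large k. It is weak: the value drops from 97 at index 24 to 78 at index
  25.\<close>

definition prime_lower :: "nat \<Rightarrow> nat" where
  "prime_lower i = (if i < 25 then small_primes ! i else 3 * (i + 1))"

lemma length_small_primes [simp]: "length small_primes = 25"
  by (simp add: small_primes_def)

lemma prime_lower_gt_1: "1 < prime_lower i"
proof (cases "i < 25")
  case True
  have "list_all (\<lambda>p. 1 < p) small_primes"
    by (simp add: small_primes_def)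
  then show ?thesis
    using True by (simp add: list_all_length prime_lower_def)
qed (simp add: prime_lower_def)

lemma length_ln_lower [simp]: "length ln_lower = 25"
  by (simp add: ln_lower_def)

lemma ln_lower_le: "i < 25 \<Longrightarrow> ln_lower ! i \<le> ln (prime_lower i)"
  using list_all2_nthD[OF ln_lower_small_primes, of i] by (simp add: prime_lower_def)

lemma small_primes_complete:
  assumes "prime p" "p < 98"
  shows "p \<in> set small_primes"
proof -
  have "list_all (\<lambda>p. prime p \<longrightarrow> p \<in> set small_primes) [0..<98]"
    by code_simp
  then have "\<forall>p<98. prime p \<longrightarrow> p \<in> set small_primes"
    by (simp add: list_all_iff del: upt_rec_numeral)
  then show ?thesis
    using assms by blast
qed

lemma sorted_small_primes: "sorted_wrt (<) small_primes"
  by (simp add: small_primes_def)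

text \<open>If \<open>xs ! j\<close> exceeds \<open>last ys\<close>, the bound is clear. Otherwise
  it occurs in \<open>ys\<close> at some index m, and m < j would give ys ! m <= xs ! m < xs ! j by
  induction, contradicting equality.\<close>

lemma strict_sorted_nth_le:
  fixes xs ys :: "nat list"
  assumes xs: "sorted_wrt (<) xs" and ys: "sorted_wrt (<) ys"
    and sub: "\<And>x. x \<in> set xs \<Longrightarrow> x \<le> last ys \<Longrightarrow> x \<in> set ys"
    and "j < length xs" "j < length ys"
  shows "ys ! j \<le> xs ! j"
  using assms(4,5)
proof (induction j rule: less_induct)
  case (less j)
  have ys_mono: "ys ! i \<le> ys ! m" if "i \<le> m" "m < length ys" for i m
    using sorted_wrt_nth_less[OF ys, of i m] that by (cases "i = m") auto
  show ?case
  proof (cases "xs ! j \<le> last ys")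
    case True
    then have "xs ! j \<in> set ys"
      using sub less.prems by simp
    then obtain m where m: "m < length ys" "ys ! m = xs ! j"
      by (auto simp: in_set_conv_nth)
    have "\<not> m < j"
    proof
      assume "m < j"
      then have "ys ! m \<le> xs ! m" "xs ! m < xs ! j"
        using less sorted_wrt_nth_less[OF xs, of m j] by auto
      then show False
        using m by simp
    qed
    then show ?thesis
      using m ys_mono[of j m] by simp
  next
    case False
    have "ys ! j \<le> ys ! (length ys - 1)"
      using ys_mono[of j "length ys - 1"] less.prems by simp
    also have "\<dots> = last ys"
      using less.prems by (subst last_conv_nth) auto
    finally show ?thesis
      using False by simp
  qed
qed

lemma prime_mod_6:
  assumes "prime (p::nat)" "3 < p"
  shows "p mod 6 = 1 \<or> p mod 6 = 5"
proof -
  have "\<not> 2 dvd p" "\<not> 3 dvd p"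
    using assms by (auto dest!: primes_dvd_imp_eq[rotated 2])
  then show ?thesis
    by presburger
qed

lemma prime_lower_le_nth:
  assumes sorted: "sorted_wrt (<) xs" and prime: "\<And>x. x \<in> set xs \<Longrightarrow> prime x"
    and "j < length xs"
  shows "prime_lower j \<le> xs ! j"
proof -
  have small: "small_primes ! i \<le> xs ! i" if "i < 25" "i < length xs" for i
  proof (rule strict_sorted_nth_le[OF sorted sorted_small_primes])
    show "x \<in> set small_primes" if "x \<in> set xs" "x \<le> last small_primes" for x
      using that small_primes_complete[of x] prime by (simp add: small_primes_def)
  qed (use that in auto)
  \<comment> \<open>Two of any three consecutive entries agree mod 6, so two steps in the list gain
    at least 6. The slack of 2 pays for i = 1, where a single step from 97 guarantees only
    98.\<close>
  have large: "97 + 3 * i \<le> xs ! (24 + i) + 2" if "24 + i < length xs" for i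
    using that
  proof (induction i rule: less_induct)
    case (less i)
    have first: "97 \<le> xs ! 24"
      using small[of 24] less.prems by (simp add: small_primes_def)
    consider "i = 0" | "i = 1" | m where "i = Suc (Suc m)"
      by (metis One_nat_def not0_implies_Suc)
    then show ?case
    proof cases
      case 1
      then show ?thesis using first by simp
    next
      case 2
      then show ?thesis
        using first less.prems sorted_wrt_nth_less[OF sorted, of 24 25] by simp
    next
      case 3
      define p q r where "p = xs ! (24 + m)" and "q = xs ! (24 + Suc m)" and "r = xs ! (24 + i)"
      have p: "97 + 3 * m \<le> p + 2"
        using less.IH[of m] less.prems 3 by (simp add: p_def)
      have less: "p < q" "q < r"
        using sorted_wrt_nth_less[OF sorted] less.prems 3 by (auto simp: p_def q_def r_def)
      have "prime p" "prime q" "prime r"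
        using prime less.prems 3 by (auto simp: p_def q_def r_def)
      then have "p mod 6 = 1 \<or> p mod 6 = 5" "q mod 6 = 1 \<or> q mod 6 = 5" "r mod 6 = 1 \<or> r mod 6 = 5"
        using p less by (intro prime_mod_6; simp)+
      then have "p mod 6 = q mod 6 \<or> q mod 6 = r mod 6 \<or> p mod 6 = r mod 6"
        by metis
      moreover have "u + 6 \<le> v" if "u < v" "u mod 6 = v mod 6" for u v :: nat
      proof -
        have "6 dvd v - u"
          using that by (metis less_imp_le mod_eq_dvd_iff_nat)
        then show ?thesis
          using that dvd_imp_le[of 6 "v - u"] by simp
      qed
      ultimately have "p + 6 \<le> r"
        using less by fastforce
      then show ?thesis
        using p 3 by (simp add: r_def)
    qed
  qed
  show ?thesis
    using small[of j] large[of "j - 24"] assms(3) by (auto simp: prime_lower_def)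
qed

section \<open>The exponent inequality\<close>

lemma exponent_inequality_of_weights:
  fixes a :: "nat \<Rightarrow> nat" and b w :: "nat \<Rightarrow> real"
  assumes "k > 0"
    and w: "\<And>i. i < k \<Longrightarrow> 0 < w i"
    and slope: "\<And>i. i < k \<Longrightarrow> w i * (a i - b i) \<le> ln (prime_lower i) * (a i - b i)"
    and balance: "(\<Sum>i<k. w i * (b i + 1)) \<le> (\<Sum>i<k. b i * ln (prime_lower i))"
    and weights: "log_plus k ^ k \<le> eta2 ^ k * (\<Prod>i<k. w i)"
  shows "(\<Prod>i<k. real (a i) + 1) \<le> (eta2 * (\<Sum>i<k. a i * ln (prime_lower i)) / (k * log_plus k)) ^ k"
proof -
  let ?S = "\<Sum>i<k. a i * ln (prime_lower i)"
  have lp: "0 < log_plus k"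
    by (simp add: log_plus_def)
  have W: "0 < (\<Prod>i<k. w i)"
    using w by (intro prod_pos) auto
  have le: "(\<Prod>i<k. w i) * (\<Prod>i<k. real (a i) + 1) \<le> (?S / k) ^ k"
    using w by (intro prod_Suc_le_of_weights[where b = b] assms) (auto intro: less_imp_le)
  have "(\<Prod>i<k. real (a i) + 1) * log_plus k ^ k
      \<le> (\<Prod>i<k. real (a i) + 1) * (eta2 ^ k * (\<Prod>i<k. w i))"
    by (intro mult_left_mono weights prod_nonneg) auto
  also have "\<dots> = eta2 ^ k * ((\<Prod>i<k. w i) * (\<Prod>i<k. real (a i) + 1))"
    by simp
  also have "\<dots> \<le> eta2 ^ k * (?S / k) ^ k"
    using eta2_pos by (intro mult_left_mono le) auto
  finally have "(\<Prod>i<k. real (a i) + 1) \<le> eta2 ^ k * (?S / k) ^ k / log_plus k ^ k"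
    using lp by (simp add: pos_le_divide_eq del: times_divide_eq_right)
  then show ?thesis
    by (simp add: power_divide power_mult_distrib)
qed

section \<open>Fewer than 25 prime factors, other than six\<close>

lemma sum_lessThan_nth: "k \<le> length xs \<Longrightarrow> (\<Sum>i<k. f (xs ! i)) = sum_list (map f (take k xs))"
  by (simp add: sum_list_sum_nth atLeast0LessThan min_absorb2)

lemma prod_lessThan_nth: "k \<le> length xs \<Longrightarrow> (\<Prod>i<k. f (xs ! i)) = prod_list (map f (take k xs))"
  by (simp add: prod.list_conv_set_nth atLeast0LessThan min_absorb2)

text \<open>
  The first inequality allows the weights \<open>min h L\<^sub>i\<close>, the second one makes them sufficient;
  entry \<open>k - 1\<close> of \<^const>\<open>ln_upper\<close> bounds \<open>log_plus k\<close>. The best cutoff \<open>h\<close> is the largest one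
  satisfying the first inequality, and the values below are close to it.
\<close>

definition cutoff_certificate :: "nat \<Rightarrow> real \<Rightarrow> bool" where
  "cutoff_certificate k h \<longleftrightarrow> 0 < h \<and>
    2 * sum_list (map (min h) (take k ln_lower)) \<le> sum_list (take k ln_lower) \<and>
    (ln_upper ! (k - 1)) ^ k \<le> 2.0907 ^ k * prod_list (map (min h) (take k ln_lower))"

lemma cutoff_certificate_table:
  "cutoff_certificate 1 0.346" "cutoff_certificate 2 0.447" "cutoff_certificate 3 0.566"
  "cutoff_certificate 4 0.668" "cutoff_certificate 5 0.794" "cutoff_certificate 7 0.979"
  "cutoff_certificate 8 1.049" "cutoff_certificate 9 1.116" "cutoff_certificate 10 1.18"
  "cutoff_certificate 11 1.24" "cutoff_certificate 12 1.3" "cutoff_certificate 13 1.35"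
  "cutoff_certificate 14 1.39" "cutoff_certificate 15 1.43" "cutoff_certificate 16 1.47"
  "cutoff_certificate 17 1.51" "cutoff_certificate 18 1.54" "cutoff_certificate 19 1.58"
  "cutoff_certificate 20 1.61" "cutoff_certificate 21 1.64" "cutoff_certificate 22 1.66"
  "cutoff_certificate 23 1.69" "cutoff_certificate 24 1.72"
  by (simp_all add: cutoff_certificate_def ln_lower_def ln_upper_def min_def power_divide)

lemma ex_cutoff_certificate:
  assumes "0 < k" "k < 25" "k \<noteq> 6"
  shows "\<exists>h. cutoff_certificate k h"
proof -
  have "k \<in> set [1..<25] - {6}"
    using assms by simp
  also have "set [1..<25] - {6} = {1, 2, 3, 4, 5, 7, 8, 9, 10, 11, 12, 13, 14, 15, 16, 17, 18, 19,
      20, 21, 22, 23, 24::nat}"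
    by code_simp
  finally show ?thesis
    using cutoff_certificate_table by blast
qed

lemma exponent_inequality_small:
  fixes a :: "nat \<Rightarrow> nat"
  assumes a: "\<And>i. i < k \<Longrightarrow> 1 \<le> a i" and k: "0 < k" "k < 25" "k \<noteq> 6"
  shows "(\<Prod>i<k. real (a i) + 1) \<le> (eta2 * (\<Sum>i<k. a i * ln (prime_lower i)) / (k * log_plus k)) ^ k"
proof -
  obtain h where h: "cutoff_certificate k h"
    using ex_cutoff_certificate k by blast
  define w where "w i = min h (ln_lower ! i)" for i
  have lower_pos: "0 < ln_lower ! i" if "i < 25" for i
  proof -
    have "list_all (\<lambda>x. 0 < x) ln_lower"
      by (simp add: ln_lower_def)
    then show ?thesis
      using that by (simp add: list_all_length)
  qed
  have w_le: "w i \<le> ln (prime_lower i)" if "i < k" for i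
    using ln_lower_le[of i] that k by (simp add: w_def)
  show ?thesis
  \<comment> \<open>With all reference exponents 1, \<open>slope\<close> asks for weights below the
    logarithms, and \<open>balance\<close> for twice the sum of the weights to stay below the sum of
    the logarithms.\<close>
  proof (rule exponent_inequality_of_weights[where b = "\<lambda>_. 1" and w = w])
    show "0 < w i" if "i < k" for i
      using h lower_pos[of i] that k by (simp add: w_def cutoff_certificate_def)
    show "w i * (real (a i) - 1) \<le> ln (prime_lower i) * (real (a i) - 1)" if "i < k" for i
      using w_le a that by (intro mult_right_mono) auto
    have "(\<Sum>i<k. w i * (1 + 1)) = 2 * (\<Sum>i<k. min h (ln_lower ! i))"
      by (simp add: w_def sum_distrib_left mult.commute)
    also have "\<dots> \<le> (\<Sum>i<k. ln_lower ! i)"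
      using h k sum_lessThan_nth[of k ln_lower "min h"] sum_lessThan_nth[of k ln_lower "\<lambda>x. x"]
      by (simp add: cutoff_certificate_def)
    also have "\<dots> \<le> (\<Sum>i<k. 1 * ln (prime_lower i))"
      using k by (auto intro!: sum_mono ln_lower_le)
    finally show "(\<Sum>i<k. w i * (1 + 1)) \<le> (\<Sum>i<k. 1 * ln (prime_lower i))" .
    have "log_plus k \<le> ln_upper ! (k - 1)"
      using list_all2_nthD[OF log_plus_upper, of "k - 1"] k by simp
    then have "log_plus k ^ k \<le> (ln_upper ! (k - 1)) ^ k"
      by (intro power_mono) (auto simp: log_plus_def)
    also have "\<dots> \<le> 2.0907 ^ k * (\<Prod>i<k. w i)"
      using h k prod_lessThan_nth[of k ln_lower "min h"]
      by (simp add: cutoff_certificate_def w_def)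
    also have "\<dots> \<le> eta2 ^ k * (\<Prod>i<k. w i)"
      using eta2_bounds h lower_pos k
      by (intro mult_right_mono power_mono prod_nonneg)
        (auto simp: w_def cutoff_certificate_def less_imp_le)
    finally show "log_plus k ^ k \<le> eta2 ^ k * (\<Prod>i<k. w i)" .
  qed (use k in auto)
qed

section \<open>Six prime factors\<close>

text \<open>
  The weights are tight at the reference exponents \<open>b = (m, 1, 1, 1, 1, 1)\<close> with \<open>m = min 3 a\<^sub>0\<close>. For
  \<open>m < 3\<close> the exponent of 2 equals \<open>m\<close>, so its weight need not be at most \<open>ln 2\<close>.
\<close>

lemma exponent_inequality_6:
  fixes a :: "nat \<Rightarrow> nat"
  assumes a: "\<And>i. i < 6 \<Longrightarrow> 1 \<le> a i"
  shows "(\<Prod>i<6. real (a i) + 1) \<le> (eta2 * (\<Sum>i<6. a i * ln (prime_lower i)) / (6 * log_plus 6)) ^ 6"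
proof -
  have six: "{..<6::nat} = {0, 1, 2, 3, 4, 5}"
    by auto
  define m where "m = min 3 (a 0)"
  have m: "m = 1 \<or> m = 2 \<or> m = 3"
    using a[of 0] by (auto simp: m_def min_def)
  define b where "b i = (if i = 0 then real m else 1)" for i :: nat
  \<comment> \<open>\<open>B\<close> is the logarithm of 2^m * 15015, lying between ln 30030 and ln
    120120. Dividing B / 6 by \<open>b i + 1\<close> makes all terms \<open>w i * (b i + 1)\<close>
    equal, which is the equality case of the mean inequality.\<close>
  define B where "B = m * ln 2 + ln 3 + ln 5 + ln 7 + ln 11 + ln (13::real)"
  define w where "w i = B / 6 / (b i + 1)" for i
  have B: "10.3 \<le> B" "B \<le> 11.7"
    using m ln_small_prime_bounds by (auto simp: B_def)
  have nonzero: "b i + 1 \<noteq> 0" for i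
    by (simp add: b_def)
  have ln_le: "ln 3 \<le> ln (prime_lower i)" if "i < 6" "i \<noteq> 0" for i
  proof -
    have "i \<in> {1, 2, 3, 4, 5}"
      using that by auto
    then show ?thesis
      by (auto simp: prime_lower_def small_primes_def)
  qed
  have lp0: "prime_lower 0 = 2"
    by (simp add: prime_lower_def small_primes_def)
  have "(\<Prod>i<6. real (a i) + 1)
      \<le> (eta2 * (\<Sum>i<6. a i * ln (prime_lower i)) / (real 6 * log_plus (real 6))) ^ 6"
  proof (rule exponent_inequality_of_weights[where b = b and w = w])
    show "0 < w i" if "i < 6" for i
      using B by (simp add: w_def b_def)
    show "w i * (real (a i) - b i) \<le> ln (prime_lower i) * (real (a i) - b i)" if "i < 6" for i
    proof (cases "i = 0")
      case True
      show ?thesis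
      proof (cases "a 0 \<le> 3")
        case True
        then show ?thesis
          using \<open>i = 0\<close> by (simp add: b_def m_def)
      next
        case False
        then have "m = 3"
          by (simp add: m_def)
        then have "w 0 \<le> ln 2"
          using B ln_2_bounds by (simp add: w_def b_def)
        then show ?thesis
          using \<open>i = 0\<close> False \<open>m = 3\<close> by (intro mult_right_mono) (auto simp: b_def lp0)
      qed
    next
      case False
      then have "w i \<le> ln 3"
        using B ln_3_bounds by (simp add: w_def b_def)
      then have "w i \<le> ln (prime_lower i)"
        using ln_le[OF that False] by simp
      then show ?thesis
        using False a[OF that] by (intro mult_right_mono) (auto simp: b_def)
    qed
    have "(\<Sum>i<6. w i * (b i + 1)) = (\<Sum>i<6::nat. B / 6)"
    proof (intro sum.cong refl)
      show "w i * (b i + 1) = B / 6" for i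
        unfolding w_def using nonzero[of i] by (rule nonzero_eq_divide_eq[THEN iffD1, OF _ refl])
    qed
    also have "\<dots> = B"
      by simp
    also have "B = (\<Sum>i<6. b i * ln (prime_lower i))"
      by (simp add: six b_def B_def prime_lower_def small_primes_def)
    finally show "(\<Sum>i<6. w i * (b i + 1)) \<le> (\<Sum>i<6. b i * ln (prime_lower i))"
      by simp
    \<comment> \<open>Since 32 (m + 1) is the number of divisors of 2^m * 15015, this is the theorem
      for these three integers, with equality for m = 2, that is, at 60060. The other two cases
      leave room for rounding.\<close>
    have "32 * (real m + 1) * ln 60060 ^ 6 \<le> 96 * B ^ 6"
    proof (cases "m = 2")
      case True
      then show ?thesis
        by (simp add: B_def ln_60060)
    next
      case False
      define c where "c = (if m = 1 then 10.3 else 11.69 :: real)"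
      have "32 * (real m + 1) * ln 60060 ^ 6 \<le> 32 * (real m + 1) * 11.0031 ^ 6"
        using ln_small_prime_bounds by (intro mult_left_mono power_mono) (auto simp: ln_60060)
      also have "\<dots> \<le> 96 * c ^ 6"
        using m False by (auto simp: c_def power_divide)
      also have "c \<le> B"
        using m False ln_small_prime_bounds by (auto simp: c_def B_def)
      then have "96 * c ^ 6 \<le> 96 * B ^ 6"
        by (intro mult_left_mono power_mono) (auto simp: c_def)
      finally show ?thesis .
    qed
    moreover define D where "D = (\<Prod>i<6. b i + 1)"
    moreover have D: "D = 32 * (real m + 1)"
      by (simp add: D_def six b_def)
    ultimately have "D * ln 60060 ^ 6 \<le> 96 * B ^ 6" "0 < D"
      by simp_all
    then have "ln 60060 ^ 6 \<le> 96 * (B ^ 6 / D)"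
      by (simp add: field_simps)
    then have "(ln 60060 / 6) ^ 6 \<le> 96 * ((B / 6) ^ 6 / D)"
      by (simp add: power_divide)
    also have "(B / 6) ^ 6 / D = (\<Prod>i<6. w i)"
      by (simp only: D_def w_def prod_dividef prod_constant card_lessThan power_divide)
    finally have "(ln 60060 / 6) ^ 6 \<le> 96 * (\<Prod>i<6. w i)" .
    then have "(6 * ln 6 / ln 60060) ^ 6 * (ln 60060 / 6) ^ 6
        \<le> (6 * ln 6 / ln 60060) ^ 6 * (96 * (\<Prod>i<6. w i))"
      by (intro mult_left_mono) auto
    also have "(6 * ln 6 / ln 60060) ^ 6 * (ln 60060 / 6) ^ 6 = ln (6::real) ^ 6"
      by (simp flip: power_mult_distrib)
    finally show "log_plus (real 6) ^ 6 \<le> eta2 ^ 6 * (\<Prod>i<6. w i)"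
      by (simp add: eta2_power_6 log_plus_def mult_ac)
  qed auto
  then show ?thesis
    by simp
qed

section \<open>At least 25 prime factors\<close>

text \<open>Comes from \<open>ln_diff_ge\<close> at 2 x - 1 and 2 x + 1, and replaces the
  exponential by a rational function in the induction below.\<close>

lemma exp_inverse_le:
  assumes "1 \<le> (x::real)"
  shows "exp (1 / x) \<le> (2 * x + 1) / (2 * x - 1)"
proof -
  have "1 / x \<le> ln (2 * x + 1) - ln (2 * x - 1)"
    using ln_diff_ge[of "2 * x - 1" "2 * x + 1"] assms by simp
  also have "\<dots> = ln ((2 * x + 1) / (2 * x - 1))"
    using assms by (simp add: ln_div)
  finally show ?thesis
    using assms by (subst (asm) ln_ge_iff) auto
qed

lemma ln_power_le_prod_ln_prime_lower:
  assumes "25 \<le> k"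
  shows "ln (real k) ^ k \<le> 2.0907 ^ k * (\<Prod>i<k. ln (prime_lower i) / 2)"
  using assms
proof (induction k rule: dec_induct)
  case base
  have "ln (25::real) ^ 25 \<le> 3.219 ^ 25"
    using ln_small_prime_bounds ln_composites by (intro power_mono) auto
  also have "\<dots> \<le> 2.0907 ^ 25 * prod_list (map (\<lambda>x. x / 2) (take 25 ln_lower))"
    by (simp add: ln_lower_def power_divide)
  also have "\<dots> = 2.0907 ^ 25 * (\<Prod>i<25. ln_lower ! i / 2)"
    by (subst prod_lessThan_nth) auto
  also have "\<dots> \<le> 2.0907 ^ 25 * (\<Prod>i<25. ln (prime_lower i) / 2)"
  proof (intro mult_left_mono prod_mono conjI)
    fix i :: nat assume "i \<in> {..<25}"
    moreover have "list_all (\<lambda>x. 0 \<le> x) ln_lower"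
      by (simp add: ln_lower_def)
    ultimately show "0 \<le> ln_lower ! i / 2"
      by (simp add: list_all_length)
    show "ln_lower ! i / 2 \<le> ln (prime_lower i) / 2"
      using ln_lower_le \<open>i \<in> {..<25}\<close> by simp
  qed auto
  finally show ?case
    by simp
next
  case (step k)
  define x y where "x = ln (real k)" and "y = ln (real (Suc k))"
  have k: "25 \<le> real k"
    using step by simp
  have "ln (25::real) \<le> x"
    using k by (simp add: x_def)
  then have x: "3.2 \<le> x"
    using ln_small_prime_bounds ln_composites by simp
  have xy: "y \<le> x + 1 / k"
    using ln_diff_le_inverse[of "real k"] k by (simp add: x_def y_def add.commute)
  have "x \<le> y"
    using k by (simp add: x_def y_def)
  have "1 / real k \<le> 0.04"
    using k by (simp add: field_simps)
  then have y: "y \<le> x + 0.04"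
    using xy by simp
  \<comment> \<open>Passing from k to k + 1 multiplies the left side by y (y / x)^k. The second
    factor is at most exp (1 / x), so only a rational inequality in x and y remains.\<close>
  have "y / x \<le> 1 + 1 / (k * x)"
    using xy x k by (simp add: field_simps)
  also have "\<dots> \<le> exp (1 / (k * x))"
    by (rule exp_ge_add_one_self)
  finally have "(y / x) ^ k \<le> exp (1 / (k * x)) ^ k"
    using x \<open>x \<le> y\<close> by (intro power_mono) auto
  also have "\<dots> = exp (1 / x)"
    using k by (simp flip: exp_of_nat_mult)
  also have "\<dots> \<le> (2 * x + 1) / (2 * x - 1)"
    using x by (intro exp_inverse_le) simp
  finally have ratio: "(y / x) ^ k \<le> (2 * x + 1) / (2 * x - 1)" .
  \<comment> \<open>Here 1.04535 is half of 2.0907, the rational lower bound for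
    \<open>eta2\<close>, and 1.098 is a lower bound for ln 3.\<close>
  have "y * (2 * x + 1) \<le> 1.04535 * (1.098 + y) * (2 * x - 1)"
  proof -
    \<comment> \<open>All terms with y are collected on the left. Their coefficient decreases in x;
      while it is nonnegative, y may be replaced by x + 0.04, and the resulting x * x is bounded
      below by 3.2 * x.\<close>
    have "y * (2.04535 - 0.0907 * x) \<le> 1.04535 * 1.098 * (2 * x - 1)"
    proof (cases "0 \<le> 2.04535 - 0.0907 * x")
      case True
      have "y * (2.04535 - 0.0907 * x) \<le> (x + 0.04) * (2.04535 - 0.0907 * x)"
        using y True by (rule mult_right_mono)
      also have "\<dots> = 2.041722 * x - 0.0907 * (x * x) + 0.081814"
        by (simp add: field_simps)
      also have "\<dots> \<le> 2.041722 * x - 0.0907 * (3.2 * x) + 0.081814"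
        using x by (intro add_mono diff_mono mult_left_mono mult_right_mono) auto
      also have "\<dots> \<le> 1.04535 * 1.098 * (2 * x - 1)"
        using x by (simp add: field_simps)
      finally show ?thesis .
    next
      case False
      then have "y * (2.04535 - 0.0907 * x) \<le> 0"
        using x \<open>x \<le> y\<close> by (intro mult_nonneg_nonpos) auto
      also have "0 \<le> 1.04535 * 1.098 * (2 * x - 1)"
        using x by simp
      finally show ?thesis .
    qed
    then show ?thesis
      by (simp add: field_simps)
  qed
  then have "y * ((2 * x + 1) / (2 * x - 1)) \<le> 1.04535 * (1.098 + y)"
    using x by (simp add: pos_divide_le_eq)
  also have "\<dots> \<le> 1.04535 * (ln 3 + y)"
    using ln_3_bounds by simp
  also have "ln 3 + y = ln (prime_lower k)"
    using step ln_mult[of 3 "real (Suc k)"] by (simp add: prime_lower_def y_def)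
  finally have y_ratio: "y * ((2 * x + 1) / (2 * x - 1)) \<le> 2.0907 * (ln (prime_lower k) / 2)"
    by simp
  have "y ^ Suc k = y * (y / x) ^ k * x ^ k"
    using x by (simp add: power_divide)
  also have "\<dots> \<le> y * ((2 * x + 1) / (2 * x - 1)) * x ^ k"
    using ratio x \<open>x \<le> y\<close> by (intro mult_right_mono mult_left_mono) auto
  also have "\<dots> \<le> 2.0907 * (ln (prime_lower k) / 2) * x ^ k"
    using y_ratio x by (intro mult_right_mono) auto
  also have "\<dots> \<le> 2.0907 * (ln (prime_lower k) / 2) * (2.0907 ^ k * (\<Prod>i<k. ln (prime_lower i) / 2))"
    using step.IH step.hyps by (intro mult_left_mono) (auto simp: x_def prime_lower_def)
  finally show ?case
    by (simp add: y_def mult_ac)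
qed

lemma exponent_inequality_large:
  fixes a :: "nat \<Rightarrow> nat"
  assumes a: "\<And>i. i < k \<Longrightarrow> 1 \<le> a i" and k: "25 \<le> k"
  shows "(\<Prod>i<k. real (a i) + 1) \<le> (eta2 * (\<Sum>i<k. a i * ln (prime_lower i)) / (k * log_plus k)) ^ k"
proof -
  define w where "w i = ln (prime_lower i) / 2" for i
  have w: "0 < w i" for i
    using prime_lower_gt_1[of i] by (simp add: w_def)
  show ?thesis
  proof (rule exponent_inequality_of_weights[where b = "\<lambda>_. 1" and w = w])
    show "w i * (real (a i) - 1) \<le> ln (prime_lower i) * (real (a i) - 1)" if "i < k" for i
      using w[of i] a[OF that] by (intro mult_right_mono) (auto simp: w_def)
    have "log_plus k ^ k \<le> 2.0907 ^ k * (\<Prod>i<k. w i)"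
      using ln_power_le_prod_ln_prime_lower[OF k] k by (simp add: log_plus_def w_def)
    also have "\<dots> \<le> eta2 ^ k * (\<Prod>i<k. w i)"
      using eta2_bounds w
      by (intro mult_right_mono power_mono prod_nonneg) (auto simp: less_imp_le)
    finally show "log_plus k ^ k \<le> eta2 ^ k * (\<Prod>i<k. w i)" .
  qed (use k w in \<open>auto simp: w_def\<close>)
qed

lemma exponent_inequality:
  fixes a :: "nat \<Rightarrow> nat"
  assumes "\<And>i. i < k \<Longrightarrow> 1 \<le> a i" "0 < k"
  shows "(\<Prod>i<k. real (a i) + 1) \<le> (eta2 * (\<Sum>i<k. a i * ln (prime_lower i)) / (k * log_plus k)) ^ k"
proof -
  consider "k < 25" "k \<noteq> 6" | "k = 6" | "25 \<le> k"
    by linarith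
  then show ?thesis
    using exponent_inequality_small[of k a] exponent_inequality_6[of a]
      exponent_inequality_large[of k a] assms by cases auto
qed

section \<open>Divisors\<close>

text \<open>A divisor is determined by its exponents at the primes of \<open>n\<close>, and these
  form a point in a box with the stated number of points.\<close>

lemma tau_le_prod_multiplicity:
  assumes "0 < n"
  shows "tau n \<le> (\<Prod>p\<in>prime_factors n. multiplicity p n + 1)"
proof -
  let ?P = "prime_factors n"
  let ?f = "\<lambda>d. restrict (\<lambda>p. multiplicity p d) ?P"
  have "card {d. d dvd n} \<le> card (PiE ?P (\<lambda>p. {..multiplicity p n}))"
  proof (rule card_inj_on_le)
    show "inj_on ?f {d. d dvd n}"
    proof (rule inj_onI)
      fix d e assume de: "d \<in> {d. d dvd n}" "e \<in> {d. d dvd n}" and eq: "?f d = ?f e"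
      show "d = e"
      proof (rule multiplicity_eq_nat)
        fix p :: nat assume p: "prime p"
        show "multiplicity p d = multiplicity p e"
        proof (cases "p \<in> ?P")
          case True
          then show ?thesis
            using fun_cong[OF eq, of p] by simp
        next
          case False
          then have "\<not> p dvd n"
            using p assms by (auto simp: prime_factors_dvd)
          then have "\<not> p dvd d" "\<not> p dvd e"
            using de by (auto intro: dvd_trans)
          then show ?thesis
            by (simp add: not_dvd_imp_multiplicity_0)
        qed
      qed (use de assms in \<open>auto intro: dvd_pos_nat\<close>)
    qed
    show "?f ` {d. d dvd n} \<subseteq> PiE ?P (\<lambda>p. {..multiplicity p n})"
      using assms by (auto intro!: dvd_imp_multiplicity_le)
  qed (auto intro: finite_PiE)
  then show ?thesis
    by (simp add: tau_def card_PiE)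
qed

lemma ln_eq_sum_multiplicity:
  assumes "0 < n"
  shows "ln (real n) = (\<Sum>p\<in>prime_factors n. multiplicity p n * ln (real p))"
proof -
  have "real n = (\<Prod>p\<in>prime_factors n. real p ^ multiplicity p n)"
    using prod_prime_factors[of n] assms by (simp flip: of_nat_power of_nat_prod)
  also have "ln \<dots> = (\<Sum>p\<in>prime_factors n. ln (real p ^ multiplicity p n))"
    by (intro ln_prod) (auto simp: prime_factors_gt_0_nat)
  also have "\<dots> = (\<Sum>p\<in>prime_factors n. multiplicity p n * ln (real p))"
    by (intro sum.cong) (auto simp: ln_realpow prime_factors_gt_0_nat)
  finally show ?thesis .
qed

lemma tau_le:
  assumes "2 \<le> n"
  shows "real (tau n) \<le> (eta2 * ln (real n) / (omega n * log_plus (omega n))) ^ omega n"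
proof -
  define xs where "xs = sorted_list_of_set (prime_factors n)"
  define k where "k = omega n"
  define a where "a i = multiplicity (xs ! i) n" for i
  have len: "length xs = k"
    by (simp add: xs_def k_def omega_def)
  have set_xs: "set xs = prime_factors n"
    by (simp add: xs_def)
  have bij: "bij_betw ((!) xs) {..<k} (prime_factors n)"
  proof (rule bij_betw_nth)
    show "distinct xs"
      by (simp add: xs_def)
  qed (simp_all add: len set_xs)
  obtain p where "prime p" "p dvd n"
    using prime_factor_nat[of n] assms by auto
  then have "prime_factors n \<noteq> {}"
    using assms by (auto simp: prime_factors_dvd)
  then have k: "0 < k"
    by (simp add: k_def omega_def card_gt_0_iff)
  have mem: "xs ! i \<in> prime_factors n" if "i < k" for i
    using that len set_xs nth_mem by blast
  have a: "1 \<le> a i" if "i < k" for i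
    using mem[OF that] assms by (simp add: a_def prime_factors_multiplicity Suc_le_eq)
  \<comment> \<open>Sorting the prime factors is what pairs the one at index i with
    \<open>prime_lower i\<close>.\<close>
  have lower: "prime_lower i \<le> xs ! i" if "i < k" for i
    using that len set_xs
    by (intro prime_lower_le_nth) (auto simp: xs_def)
  have lower_pos: "0 < prime_lower i" for i
    using prime_lower_gt_1[of i] by simp
  have "real (tau n) \<le> real (\<Prod>p\<in>prime_factors n. multiplicity p n + 1)"
    using tau_le_prod_multiplicity[of n] assms by (intro of_nat_mono) simp
  also have "\<dots> = (\<Prod>i<k. real (a i) + 1)"
    by (simp add: a_def prod.reindex_bij_betw[OF bij, symmetric] add.commute)
  also have "\<dots> \<le> (eta2 * (\<Sum>i<k. a i * ln (prime_lower i)) / (k * log_plus k)) ^ k"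
    using a k by (rule exponent_inequality)
  also have "\<dots> \<le> (eta2 * ln (real n) / (k * log_plus k)) ^ k"
  proof (intro power_mono divide_right_mono mult_left_mono)
    have "(\<Sum>i<k. a i * ln (prime_lower i)) \<le> (\<Sum>i<k. a i * ln (real (xs ! i)))"
      using lower lower_pos by (intro sum_mono mult_left_mono ln_mono) (auto simp: less_le_trans)
    also have "\<dots> = ln (real n)"
      using assms by (simp add: ln_eq_sum_multiplicity a_def sum.reindex_bij_betw[OF bij, symmetric])
    finally show "(\<Sum>i<k. a i * ln (prime_lower i)) \<le> ln (real n)" .
    show "0 \<le> eta2 * (\<Sum>i<k. a i * ln (prime_lower i)) / (k * log_plus k)"
      using eta2_pos lower_pos
      by (intro divide_nonneg_nonneg mult_nonneg_nonneg sum_nonneg)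
        (auto simp: log_plus_def Suc_le_eq)
  qed (use eta2_pos in \<open>auto simp: log_plus_def\<close>)
  finally show ?thesis
    by (simp add: k_def)
qed

theorem theorem1:
  shows "(\<forall>n::nat. n \<ge> 2 \<longrightarrow>
            real (tau n) \<le> (eta2 * ln (real n) / (real (omega n) * log_plus (real (omega n)))) ^ omega n)
         \<and> 2.0907132 \<le> eta2 \<and> eta2 < 2.0907133"
  by (intro conjI allI impI tau_le eta2_bounds)

end
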